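(* Let $p$ be a prime, and let $G$ be a (not necessarily finite) $p$-group which is nilpotent of class $k\geq 1$ and has finite exponent $\exp(G)=p^e$. Put $m=\lfloor\log_p k\rfloor$. Then for every integer $c\geq 1$, $\exp(M^{(c)}(G))$ divides $\exp(G)\,p^{m(k-1)}$.
   Context: For a group $G$ presented as a quotient $G\cong F/R$ of a free group $F$ by a normal subgroup $R$, and an integer $c\geq 1$, the $c$-nilpotent multiplier of $G$ is $M^{(c)}(G)=\dfrac{R\cap\gamma_{c+1}(F)}{[R,\,{}_cF]}$, where $\gamma_i(F)$ denotes the $i$-th term of the lower central series of $F$ (with $\gamma_1(F)=F$) and $[R,\,{}_cF]$ denotes the left-normed commutator subgroup $[R,F,\dots,F]$ with $c$ copies of $F$, i.e. $[R,\,{}_1F]=[R,F]$ and $[R,\,{}_{i+1}F]=[[R,\,{}_iF],F]$. Up to isomorphism, $M^{(c)}(G)$ does not depend on the chosen free presentation. The case $c=1$ is the Schur multiplier $M(G)=M^{(1)}(G)$. For a group $H$, $\exp(H)$ denotes the exponent of $H$: the least positive integer $n$ with $h^n=1$ for all $h\in H$. *)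

theory Defs
  imports Complex_Main "HOL-Algebra.Algebra"
begin

section \<open>Free groups\<close>

text \<open>The letter \<open>(True, x)\<close> stands for the generator \<open>x\<close>, and \<open>(False, x)\<close> for its
  formal inverse.\<close>

type_synonym 'x word = "(bool \<times> 'x) list"

definition flip :: "bool \<times> 'x \<Rightarrow> bool \<times> 'x" where
  "flip a = (\<not> fst a, snd a)"

definition reduced :: "'x word \<Rightarrow> bool" where
  "reduced w \<longleftrightarrow> successively (\<lambda>a b. b \<noteq> flip a) w"

text \<open>For reduced \<open>v\<close>, \<open>foldr cons_red u v\<close> is the free reduction of \<open>u @ v\<close>.\<close>

fun cons_red :: "bool \<times> 'x \<Rightarrow> 'x word \<Rightarrow> 'x word" where
  "cons_red a [] = [a]"
| "cons_red a (b # w) = (if b = flip a then w else a # b # w)"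

definition free_group :: "'x set \<Rightarrow> 'x word monoid" where
  "free_group S =
    \<lparr>carrier = {w. reduced w \<and> snd ` set w \<subseteq> S},
     monoid.mult = (\<lambda>u v. foldr cons_red u v),
     one = []\<rparr>"

definition eval_word :: "('a, 'b) monoid_scheme \<Rightarrow> 'a word \<Rightarrow> 'a" where
  "eval_word G w =
    foldr (\<lambda>(b, x) g. (if b then x else inv\<^bsub>G\<^esub> x) \<otimes>\<^bsub>G\<^esub> g) w \<one>\<^bsub>G\<^esub>"

text \<open>\<open>F\<close> is free with basis \<open>S\<close>: the inclusion of \<open>S\<close> induces an isomorphism from the
  group of reduced words over \<open>S\<close> onto \<open>F\<close>.\<close>

definition free_on :: "('a, 'b) monoid_scheme \<Rightarrow> 'a set \<Rightarrow> bool" where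
  "free_on F S \<longleftrightarrow> group F \<and> S \<subseteq> carrier F \<and> eval_word F \<in> iso (free_group S) F"

lemma flip_flip [simp]: "flip (flip a) = a"
  by (simp add: flip_def)

lemma flip_neq [simp]: "flip a \<noteq> a"
  by (simp add: flip_def prod_eq_iff)

lemma snd_flip [simp]: "snd (flip a) = snd a"
  by (simp add: flip_def)

lemma reduced_Nil [simp]: "reduced []"
  by (simp add: reduced_def)

lemma reduced_ConsD: "reduced (a # w) \<Longrightarrow> reduced w"
  by (cases w) (auto simp: reduced_def)

lemma cons_red_reduced [simp]: "reduced (a # w) \<Longrightarrow> cons_red a w = a # w"
  by (cases w) (auto simp: reduced_def)

lemma reduced_cons_red [simp]: "reduced w \<Longrightarrow> reduced (cons_red a w)"
  by (cases w) (auto simp: reduced_def dest: reduced_ConsD[unfolded reduced_def])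

lemma cons_red_flip_left [simp]:
  assumes "reduced w" shows "cons_red (flip a) (cons_red a w) = w"
proof (cases w)
  case (Cons b v)
  then show ?thesis using assms
    by (cases v) (auto simp: reduced_def)
qed auto

lemma cons_red_flip_right [simp]:
  assumes "reduced w" shows "cons_red a (cons_red (flip a) w) = w"
  using cons_red_flip_left[of w "flip a"] assms by simp

lemma reduced_foldr_cons_red [simp]: "reduced v \<Longrightarrow> reduced (foldr cons_red u v)"
  by (induction u) auto

lemma snd_set_cons_red: "snd ` set (cons_red a w) \<subseteq> insert (snd a) (snd ` set w)"
  by (cases w) auto

lemma snd_set_foldr_cons_red:
  "snd ` set (foldr cons_red u v) \<subseteq> snd ` set u \<union> snd ` set v"
proof (induction u)
  case (Cons a u)
  have "snd ` set (cons_red a (foldr cons_red u v))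
      \<subseteq> insert (snd a) (snd ` set (foldr cons_red u v))"
    by (rule snd_set_cons_red)
  also have "\<dots> \<subseteq> insert (snd a) (snd ` set u \<union> snd ` set v)"
    using Cons by blast
  finally show ?case by simp
qed auto

lemma foldr_cons_red_cons_red:
  "reduced w \<Longrightarrow> foldr cons_red (cons_red a v) w = cons_red a (foldr cons_red v w)"
  by (cases v) auto

lemma foldr_cons_red_assoc:
  "reduced w \<Longrightarrow>
    foldr cons_red (foldr cons_red u v) w = foldr cons_red u (foldr cons_red v w)"
  by (induction u) (auto simp: foldr_cons_red_cons_red)

lemma foldr_cons_red_Nil: "reduced u \<Longrightarrow> foldr cons_red u [] = u"
proof (induction u)
  case (Cons a u)
  then have "foldr cons_red u [] = u" by (blast dest: reduced_ConsD)
  then show ?case using Cons.prems by simp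
qed auto

lemma foldr_cons_red_inverse:
  "reduced u \<Longrightarrow> reduced v \<Longrightarrow>
    foldr cons_red (rev (map flip u)) (foldr cons_red u v) = v"
  by (induction u arbitrary: v) (auto dest: reduced_ConsD)

lemma free_group_is_group: "group (free_group S)"
proof (rule groupI)
  fix u v assume "u \<in> carrier (free_group S)" "v \<in> carrier (free_group S)"
  then have "reduced v" "snd ` set u \<union> snd ` set v \<subseteq> S"
    by (simp_all add: free_group_def)
  then show "u \<otimes>\<^bsub>free_group S\<^esub> v \<in> carrier (free_group S)"
    using order_trans[OF snd_set_foldr_cons_red[of u v]] by (simp add: free_group_def)
next
  fix u assume u: "u \<in> carrier (free_group S)"
  let ?v = "foldr cons_red (rev (map flip u)) []"
  have "snd ` set (rev (map flip u)) = snd ` set u"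
    by (auto simp: image_image)
  then have "?v \<in> carrier (free_group S)"
    using u order_trans[OF snd_set_foldr_cons_red[of "rev (map flip u)" "[]"]]
    by (simp add: free_group_def)
  moreover have "foldr cons_red ?v u = []"
  proof -
    have "foldr cons_red ?v u = foldr cons_red (rev (map flip u)) (foldr cons_red [] u)"
      using u by (intro foldr_cons_red_assoc) (auto simp: free_group_def)
    also have "\<dots> = foldr cons_red (rev (map flip u)) (foldr cons_red u [])"
      using u by (simp add: foldr_cons_red_Nil free_group_def)
    also have "\<dots> = []"
      using u by (intro foldr_cons_red_inverse) (auto simp: free_group_def)
    finally show ?thesis .
  qed
  ultimately show "\<exists>y\<in>carrier (free_group S). y \<otimes>\<^bsub>free_group S\<^esub> u = \<one>\<^bsub>free_group S\<^esub>"
    by (intro bexI[of _ ?v]) (auto simp: free_group_def)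
qed (auto simp: free_group_def foldr_cons_red_assoc)

lemma eval_word_simps [simp]:
  "eval_word G [] = \<one>\<^bsub>G\<^esub>"
  "eval_word G (a # w) = (if fst a then snd a else inv\<^bsub>G\<^esub> (snd a)) \<otimes>\<^bsub>G\<^esub> eval_word G w"
  by (simp_all add: eval_word_def split: prod.splits)

lemma (in group) eval_word_closed:
  "snd ` set w \<subseteq> carrier G \<Longrightarrow> eval_word G w \<in> carrier G"
  by (induction w) auto

lemma (in group) eval_word_cons_red:
  assumes "snd a \<in> carrier G" "snd ` set w \<subseteq> carrier G"
  shows "eval_word G (cons_red a w) = eval_word G (a # w)"
proof (cases w)
  case (Cons b v)
  have "eval_word G v \<in> carrier G"
    using assms(2) Cons by (intro eval_word_closed) auto
  then show ?thesis using assms Cons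
    by (auto simp: flip_def m_assoc [symmetric])
qed auto

lemma (in group) eval_word_foldr_cons_red:
  assumes "snd ` set u \<subseteq> carrier G" "snd ` set v \<subseteq> carrier G"
  shows "eval_word G (foldr cons_red u v) = eval_word G u \<otimes> eval_word G v"
  using assms(1)
proof (induction u)
  case Nil
  then show ?case using eval_word_closed[OF assms(2)] by simp
next
  case (Cons a u)
  have sub: "snd ` set (foldr cons_red u v) \<subseteq> carrier G"
    using Cons.prems assms(2) snd_set_foldr_cons_red[of u v]
    by (intro order_trans[OF snd_set_foldr_cons_red]) auto
  have "eval_word G u \<in> carrier G" "eval_word G v \<in> carrier G"
    using Cons.prems assms(2) by (auto intro!: eval_word_closed)
  then show ?case
    using Cons sub by (simp add: eval_word_cons_red m_assoc)
qed

lemma (in group) eval_word_hom: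
  assumes "S \<subseteq> carrier G"
  shows "eval_word G \<in> hom (free_group S) G"
proof (rule homI)
  fix u assume "u \<in> carrier (free_group S)"
  then show "eval_word G u \<in> carrier G"
    using assms by (intro eval_word_closed) (auto simp: free_group_def)
next
  fix u v assume uv: "u \<in> carrier (free_group S)" "v \<in> carrier (free_group S)"
  then have "snd ` set u \<subseteq> carrier G" "snd ` set v \<subseteq> carrier G"
    using assms by (auto simp: free_group_def)
  then show "eval_word G (u \<otimes>\<^bsub>free_group S\<^esub> v) = eval_word G u \<otimes> eval_word G v"
    by (simp add: free_group_def eval_word_foldr_cons_red)
qed

lemma inv_free_group_generator:
  assumes "x \<in> S" shows "inv\<^bsub>free_group S\<^esub> [(True, x)] = [(False, x)]"
proof -
  interpret group "free_group S" by (rule free_group_is_group)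
  show ?thesis
    using assms by (intro inv_equality) (auto simp: free_group_def reduced_def flip_def)
qed

lemma free_on_free_group: "free_on (free_group S) ((\<lambda>x. [(True, x)]) ` S)"
proof -
  let ?F = "free_group S" and ?g = "\<lambda>x. [(True, x)]"
  let ?B = "?g ` S" and ?m = "map (\<lambda>(b, x). (b, [(True, x)]))"
  interpret group ?F by (rule free_group_is_group)
  have B: "?B \<subseteq> carrier ?F"
    by (simp add: image_subset_iff free_group_def reduced_def)
  have inj: "(case b of (b, x) \<Rightarrow> (b, ?g x)) = flip (case c of (b, x) \<Rightarrow> (b, ?g x))
      \<longleftrightarrow> b = flip c" for b c :: "bool \<times> 'a"
    by (cases b; cases c) (simp add: flip_def)
  have red: "reduced (?m w) \<longleftrightarrow> reduced w" for w :: "'a word"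
    by (simp add: reduced_def successively_map inj)
  have ev: "eval_word ?F (?m w) = w" if "w \<in> carrier ?F" for w
    using that
  proof (induction w)
    case (Cons a w)
    then have w: "w \<in> carrier ?F" and a: "snd a \<in> S" and r: "reduced (a # w)"
      by (auto simp: free_group_def dest: reduced_ConsD)
    have "eval_word ?F (?m (a # w)) = [a] \<otimes>\<^bsub>?F\<^esub> w"
      using Cons.IH[OF w] a by (cases a) (auto simp: inv_free_group_generator)
    then show ?case using r by (simp add: free_group_def)
  qed (simp add: free_group_def)
  have car: "carrier (free_group ?B) = ?m ` carrier ?F"
  proof (intro equalityI subsetI)
    fix v assume v: "v \<in> carrier (free_group ?B)"
    let ?w = "map (\<lambda>(b, u). (b, snd (hd u))) v"
    have gen: "\<exists>x\<in>S. snd a = [(True, x)]" if "a \<in> set v" for a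
      using v that by (auto simp: free_group_def)
    have eq: "?m ?w = v"
      unfolding map_map
    proof (rule map_idI)
      fix a assume "a \<in> set v"
      then obtain x where "snd a = [(True, x)]" using gen by blast
      then show "((\<lambda>(b, x). (b, [(True, x)])) \<circ> (\<lambda>(b, u). (b, snd (hd u)))) a = a"
        by (simp add: case_prod_beta prod_eq_iff)
    qed
    have "snd ` set ?w \<subseteq> S"
    proof
      fix x assume "x \<in> snd ` set ?w"
      then obtain a where a: "a \<in> set v" "x = snd (hd (snd a))"
        by (auto simp: case_prod_beta)
      then show "x \<in> S" using gen[OF a(1)] by auto
    qed
    moreover have "reduced ?w"
      using v red[of ?w] unfolding eq by (simp add: free_group_def)
    ultimately have "?w \<in> carrier ?F" by (simp add: free_group_def)
    then show "v \<in> ?m ` carrier ?F" using eq by (rule image_eqI[rotated, OF _ sym])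
  next
    fix v assume "v \<in> ?m ` carrier ?F"
    then obtain w where w: "v = ?m w" "w \<in> carrier ?F" by blast
    then have "reduced v" by (simp add: red free_group_def)
    moreover have "snd ` set v \<subseteq> ?B"
    proof
      fix y assume "y \<in> snd ` set v"
      then obtain a where a: "a \<in> set w" "y = [(True, snd a)]"
        using w(1) by (auto simp: case_prod_beta)
      moreover from a have "snd a \<in> S" using w(2) by (auto simp: free_group_def)
      ultimately show "y \<in> ?B" by auto
    qed
    ultimately show "v \<in> carrier (free_group ?B)" by (simp add: free_group_def)
  qed
  have "bij_betw (eval_word ?F) (carrier (free_group ?B)) (carrier ?F)"
    by (rule bij_betw_byWitness[where f' = ?m]) (auto simp: car ev)
  then show ?thesis
    using B eval_word_hom[OF B] free_group_is_group
    by (auto simp: free_on_def iso_def)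
qed

section \<open>Commutator subgroups and nilpotency\<close>

text \<open>The commutator convention \<open>h k h\<inverse> k\<inverse>\<close> is that of \<^const>\<open>derived\<close>;
  for subgroups \<open>H\<close> and \<open>K\<close>, the convention \<open>h\<inverse> k\<inverse> h k\<close> generates the same subgroup.\<close>

definition commutator_subgroup ::
    "('a, 'b) monoid_scheme \<Rightarrow> 'a set \<Rightarrow> 'a set \<Rightarrow> 'a set" where
  "commutator_subgroup G H K =
    generate G (\<Union>h\<in>H. \<Union>k\<in>K. {h \<otimes>\<^bsub>G\<^esub> k \<otimes>\<^bsub>G\<^esub> inv\<^bsub>G\<^esub> h \<otimes>\<^bsub>G\<^esub> inv\<^bsub>G\<^esub> k})"

lemma commutator_subgroup_self: "commutator_subgroup G H H = derived G H"
  by (simp add: commutator_subgroup_def derived_def)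

text \<open>\<open>iterated_commutator G H c\<close> is the left-normed \<open>[H, G, \<dots>, G]\<close> with \<open>c\<close> copies
  of \<open>G\<close>.\<close>

primrec iterated_commutator ::
    "('a, 'b) monoid_scheme \<Rightarrow> 'a set \<Rightarrow> nat \<Rightarrow> 'a set" where
  "iterated_commutator G H 0 = H"
| "iterated_commutator G H (Suc c) =
    commutator_subgroup G (iterated_commutator G H c) (carrier G)"

text \<open>Indexed from \<open>1\<close>; the value at \<open>0\<close> is a dummy.\<close>

definition lower_central :: "('a, 'b) monoid_scheme \<Rightarrow> nat \<Rightarrow> 'a set" where
  "lower_central G i = iterated_commutator G (carrier G) (i - 1)"

definition nilpotent_of_class :: "('a, 'b) monoid_scheme \<Rightarrow> nat \<Rightarrow> bool" where
  "nilpotent_of_class G k \<longleftrightarrow>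
    lower_central G (k + 1) = {\<one>\<^bsub>G\<^esub>} \<and> (\<forall>j<k. lower_central G (j + 1) \<noteq> {\<one>\<^bsub>G\<^esub>})"

section \<open>Exponents, \<open>p\<close>-groups and nilpotent multipliers\<close>

text \<open>The exponent is \<open>0\<close> if no positive \<open>n\<close> annihilates the group. Hence an exponent
  dividing a positive number is in particular finite.\<close>

definition group_exponent :: "('a, 'b) monoid_scheme \<Rightarrow> nat" where
  "group_exponent G =
    (if \<exists>n>0. \<forall>x\<in>carrier G. x [^]\<^bsub>G\<^esub> (n::nat) = \<one>\<^bsub>G\<^esub>
     then LEAST n. n > 0 \<and> (\<forall>x\<in>carrier G. x [^]\<^bsub>G\<^esub> n = \<one>\<^bsub>G\<^esub>)
     else 0)"

text \<open>Elements of infinite order have \<^const>\<open>group.ord\<close> equal to \<open>0\<close>, so they are excluded.\<close>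

definition p_group :: "nat \<Rightarrow> ('a, 'b) monoid_scheme \<Rightarrow> bool" where
  "p_group p G \<longleftrightarrow> group G \<and> (\<forall>x\<in>carrier G. \<exists>n. group.ord G x = p ^ n)"

definition free_presentation ::
    "('a, 'b) monoid_scheme \<Rightarrow> ('f, 'd) monoid_scheme \<Rightarrow> 'f set \<Rightarrow> bool" where
  "free_presentation G F R \<longleftrightarrow> (\<exists>S. free_on F S) \<and> R \<lhd> F \<and> F Mod R \<cong> G"

text \<open>The \<open>c\<close>-nilpotent multiplier of \<open>F Mod R\<close>, computed from this presentation.\<close>

definition nilpotent_multiplier ::
    "nat \<Rightarrow> ('f, 'd) monoid_scheme \<Rightarrow> 'f set \<Rightarrow> 'f set monoid" where
  "nilpotent_multiplier c F R =
    F\<lparr>carrier := R \<inter> lower_central F (c + 1)\<rparr> Mod iterated_commutator F R c"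

end

theory Submission
  imports Defs
begin

text \<open>
  Put \<open>K = [R, \<^sub>cF]\<close>. All computations take place in \<open>F\<close>; what \<open>G\<close> contributes is the
  inclusion \<open>\<gamma>\<^bsub>k+1\<^esub>(F) \<subseteq> R\<close>, hence \<open>\<gamma>\<^bsub>c+k+1\<^esub>(F) \<subseteq> K\<close>, and the fact that \<open>p ^ e\<close>-th powers lie
  in \<open>R\<close>. The claim is that for \<open>d < k\<close> and \<open>N = p ^ (e + m * d)\<close> every \<open>w \<in> \<gamma>\<^bsub>c+k-d\<^esub>(F)\<close> satisfies
  \<open>w ^ N \<in> K\<close>; the case \<open>d = k - 1\<close> bounds the exponent of the multiplier, a subgroup of
  \<open>\<gamma>\<^bsub>c+1\<^esub>(F) / K\<close>. The proof of the claim is an induction on \<open>d\<close>; let \<open>s = c + k - d - 1 \<ge> c\<close>.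

  If \<open>w\<close> were a single commutator \<open>[x, y\<^sub>1, \<dots>, y\<^sub>s]\<close>, one would compare \<open>w ^ N\<close> with
  \<open>[x ^ N, y\<^sub>1, \<dots>, y\<^sub>s]\<close>, which lies in \<open>[R, \<^sub>sF] \<subseteq> K\<close> because \<open>x ^ N \<in> R\<close>. A collection formula
  says that the two agree up to a product of powers \<open>h ^ (N choose q)\<close> with \<open>q \<ge> 2\<close> and
  \<open>h \<in> \<gamma>\<^bsub>s+q\<^esub>(F)\<close>. If \<open>d = 0\<close> or \<open>q > k\<close>, such an \<open>h\<close> is in \<open>\<gamma>\<^bsub>c+k+1\<^esub>(F) \<subseteq> K\<close>. Otherwise
  \<open>q \<le> k < p ^ (m + 1)\<close>, the binomial coefficient is divisible by \<open>p ^ (e + m * (d - 1))\<close>, and the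
  induction hypothesis for \<open>d - 1\<close> applies to \<open>h\<close>.

  The collection formula comes from polynomial sequences in the sense of Lazard and Leibman:
  sequences \<open>f\<close> in a filtered group such that, for all \<open>j\<close>, the \<open>j\<close>-th iterated differences take
  values in the term of index \<open>i + j\<close> of the filtration. These are closed under products and
  commutators, the index \<open>i\<close> being additive for the latter (\<open>poly_seq_mult\<close>, \<open>poly_seq_comm\<close>), and
  up to any given \<open>n\<close> they are products of powers \<open>h ^ (n choose q)\<close> with \<open>h\<close> in the term of
  index \<open>i + q\<close>; this enters through \<open>poly_seq_vanish\<close>. Applying the closure properties
  to \<open>n \<mapsto> x ^ n\<close> and to constants yields, for every \<open>w \<in> \<gamma>\<^bsub>s+1\<^esub>(F)\<close> and not only for single commutators, a polynomial sequence with values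
  \<open>\<one>\<close> at \<open>0\<close>, \<open>w\<close> at \<open>1\<close> and an element of \<open>[R, \<^sub>sF]\<close> at \<open>N\<close> (\<open>lower_central_interpolation\<close>).
\<close>

section \<open>Commutator calculus\<close>

context group
begin

lemma inv_mult_cancel [simp]:
  "x \<in> carrier G \<Longrightarrow> y \<in> carrier G \<Longrightarrow> inv x \<otimes> (x \<otimes> y) = y"
  "x \<in> carrier G \<Longrightarrow> y \<in> carrier G \<Longrightarrow> x \<otimes> (inv x \<otimes> y) = y"
  by (simp_all flip: m_assoc)

lemma subgroup_nat_pow_closed: "subgroup K G \<Longrightarrow> x \<in> K \<Longrightarrow> x [^] (n::nat) \<in> K"
  by (induction n) (simp_all add: subgroup.one_closed subgroup.m_closed)

definition comm :: "'a \<Rightarrow> 'a \<Rightarrow> 'a" where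
  "comm x y = x \<otimes> y \<otimes> inv x \<otimes> inv y"

lemma comm_closed [simp]: "x \<in> carrier G \<Longrightarrow> y \<in> carrier G \<Longrightarrow> comm x y \<in> carrier G"
  by (simp add: comm_def)

lemmas comm_simps = comm_def m_assoc inv_mult_group

lemma comm_mult_left:
  assumes "x \<in> carrier G" "y \<in> carrier G" "z \<in> carrier G"
  shows "comm (x \<otimes> y) z = comm x (comm y z) \<otimes> comm y z \<otimes> comm x z"
  using assms by (simp add: comm_simps)

lemma comm_mult_right:
  assumes "x \<in> carrier G" "y \<in> carrier G" "z \<in> carrier G"
  shows "comm x (y \<otimes> z) = comm x y \<otimes> comm y (comm x z) \<otimes> comm x z"
  using assms by (simp add: comm_simps)

lemma comm_one_left [simp]: "y \<in> carrier G \<Longrightarrow> comm \<one> y = \<one>"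
  by (simp add: comm_def)

lemma commutator_subgroup_alt:
  "commutator_subgroup G A B = generate G (\<Union>a\<in>A. \<Union>b\<in>B. {comm a b})"
  by (simp add: commutator_subgroup_def comm_def)

lemma comm_in_commutator_subgroup:
  "a \<in> A \<Longrightarrow> b \<in> B \<Longrightarrow> comm a b \<in> commutator_subgroup G A B"
  unfolding commutator_subgroup_alt by (rule generate.incl) blast

lemma commutator_subgroup_le:
  assumes "\<And>a b. a \<in> A \<Longrightarrow> b \<in> B \<Longrightarrow> comm a b \<in> C" "subgroup C G"
  shows "commutator_subgroup G A B \<subseteq> C"
  unfolding commutator_subgroup_alt using assms by (intro generate_subgroup_incl) auto

lemma commutator_subgroup_normal:
  assumes "A \<lhd> G" "B \<lhd> G"
  shows "commutator_subgroup G A B \<lhd> G"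
  unfolding commutator_subgroup_alt
proof (rule normal_generateI)
  have sub: "A \<subseteq> carrier G" "B \<subseteq> carrier G"
    using assms by (simp_all add: normal_imp_subgroup subgroup.subset)
  then show "(\<Union>a\<in>A. \<Union>b\<in>B. {comm a b}) \<subseteq> carrier G"
    using comm_closed by blast
  fix h g assume "h \<in> (\<Union>a\<in>A. \<Union>b\<in>B. {comm a b})" and g: "g \<in> carrier G"
  then obtain a b where ab: "a \<in> A" "b \<in> B" "h = comm a b" by blast
  then have "g \<otimes> h \<otimes> inv g = comm (g \<otimes> a \<otimes> inv g) (g \<otimes> b \<otimes> inv g)"
    using sub[THEN subsetD] g by (simp add: comm_simps)
  moreover have "g \<otimes> a \<otimes> inv g \<in> A" "g \<otimes> b \<otimes> inv g \<in> B"
    using ab g normal.inv_op_closed2[OF assms(1)] normal.inv_op_closed2[OF assms(2)] by blast+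
  ultimately show "g \<otimes> h \<otimes> inv g \<in> (\<Union>a\<in>A. \<Union>b\<in>B. {comm a b})" by blast
qed

lemma comm_mem_normal:
  assumes "C \<lhd> G" "x \<in> C" "y \<in> carrier G"
  shows "comm x y \<in> C" "comm y x \<in> C"
proof -
  interpret normal C G by fact
  have x: "x \<in> carrier G" using assms(2) by simp
  have "comm x y = x \<otimes> (y \<otimes> inv x \<otimes> inv y)" "comm y x = (y \<otimes> x \<otimes> inv y) \<otimes> inv x"
    using x assms(3) by (simp_all add: comm_simps)
  then show "comm x y \<in> C" "comm y x \<in> C"
    using assms inv_op_closed2[OF assms(3)] by simp_all
qed

section \<open>Iterated commutators and the lower central series\<close>

lemma iterated_commutator_normal:
  "A \<lhd> G \<Longrightarrow> iterated_commutator G A n \<lhd> G"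
  by (induction n) (simp_all add: commutator_subgroup_normal normal_self)

lemma iterated_commutator_subgroup:
  "A \<lhd> G \<Longrightarrow> subgroup (iterated_commutator G A n) G"
  by (rule normal_imp_subgroup[OF iterated_commutator_normal])

lemma iterated_commutator_antimono:
  assumes "A \<lhd> G" "i \<le> j"
  shows "iterated_commutator G A j \<subseteq> iterated_commutator G A i"
  using assms(2)
proof (induction rule: dec_induct)
  case (step n)
  have "iterated_commutator G A (Suc n) \<subseteq> iterated_commutator G A n"
    unfolding iterated_commutator.simps
    by (intro commutator_subgroup_le comm_mem_normal iterated_commutator_normal
        iterated_commutator_subgroup assms)
  then show ?case using step.IH by blast
qed simp

lemma iterated_commutator_mono:
  assumes "A \<subseteq> B" "B \<lhd> G"
  shows "iterated_commutator G A n \<subseteq> iterated_commutator G B n"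
proof (induction n)
  case (Suc n)
  then show ?case
    using iterated_commutator_subgroup[OF assms(2), of "Suc n"]
    unfolding iterated_commutator.simps
    by (intro commutator_subgroup_le comm_in_commutator_subgroup) blast+
qed (use assms in simp)

lemma iterated_commutator_add:
  "iterated_commutator G (iterated_commutator G A m) n = iterated_commutator G A (m + n)"
  by (induction n) simp_all

text \<open>Modulo \<open>L (i + j + 2)\<close> and with \<open>z = [b, y] \<in> L (j + 1)\<close>, conjugation by \<open>a \<in> L i\<close> multiplies
  \<open>b\<close> by a central element and \<open>y\<close> by an element \<open>u \<in> L (i + 1)\<close> that commutes with \<open>L j\<close>; hence it
  fixes \<open>z\<close>.\<close>

lemma comm_iterated_commutator:
  defines "L \<equiv> iterated_commutator G (carrier G)"
  assumes "a \<in> L i" "z \<in> L j"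
  shows "comm a z \<in> L (Suc (i + j))"
  using assms(2,3)
proof (induction j arbitrary: i a z)
  case 0
  then show ?case by (auto simp: L_def intro: comm_in_commutator_subgroup)
next
  case (Suc j)
  have normal: "L n \<lhd> G" for n
    unfolding L_def by (rule iterated_commutator_normal[OF normal_self])
  note sub = normal[THEN normal_imp_subgroup]
  have car: "x \<in> L n \<Longrightarrow> x \<in> carrier G" for x n
    using subgroup.subset[OF sub] by blast
  define C where "C = L (Suc (i + Suc j))"
  have C: "C \<lhd> G" "subgroup C G" by (simp_all add: C_def normal sub)
  have a: "a \<in> L i" "a \<in> carrier G" using Suc.prems car by auto
  define S where "S = {z \<in> carrier G. comm a z \<in> C}"
  have "L (Suc j) \<subseteq> S"
    unfolding L_def iterated_commutator.simps
  proof (rule commutator_subgroup_le)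
    fix b y assume "b \<in> iterated_commutator G (carrier G) j" and y: "y \<in> carrier G"
    then have b: "b \<in> L j" "b \<in> carrier G" using car by (auto simp: L_def)
    define v u where "v = comm a b" and "u = comm a y"
    have v: "v \<in> L (Suc (i + j))" using Suc.IH[OF a(1) b(1)] by (simp add: v_def)
    have u: "u \<in> L (Suc i)"
      using a y by (auto simp: u_def L_def intro: comm_in_commutator_subgroup)
    note uv = car[OF u] car[OF v]
    have by_L: "comm b y \<in> L j" by (rule comm_mem_normal(1)[OF normal b(1) y])
    have v_comm: "comm v x \<in> C" if "x \<in> carrier G" for x
      using v that by (auto simp: C_def L_def intro: comm_in_commutator_subgroup)
    have u_comm: "comm u x \<in> C" if "x \<in> L j" for x
      using Suc.IH[OF u that] by (simp add: C_def)
    have "comm a (comm b y)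
      = comm v (comm b (u \<otimes> y)) \<otimes> (inv (comm u b) \<otimes> comm u (comm b y)) \<otimes>
        (comm b y \<otimes> comm v (u \<otimes> y) \<otimes> inv (comm b y))"
      using a b y unfolding u_def v_def by (simp add: comm_simps)
    moreover have "comm v (comm b (u \<otimes> y)) \<in> C" "inv (comm u b) \<in> C" "comm u (comm b y) \<in> C"
      using v_comm u_comm b y uv by_L C by (simp_all add: subgroup.m_inv_closed)
    moreover have "comm b y \<otimes> comm v (u \<otimes> y) \<otimes> inv (comm b y) \<in> C"
      using v_comm b y uv C by (simp add: normal.inv_op_closed2)
    ultimately have "comm a (comm b y) \<in> C"
      using C by (simp add: subgroup.m_closed)
    then show "comm b y \<in> S" using b y by (simp add: S_def)
  next
    show "subgroup S G"
    proof
      fix x y assume "x \<in> S" "y \<in> S"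
      moreover from this have "comm a (x \<otimes> y) = comm a x \<otimes> (x \<otimes> comm a y \<otimes> inv x)"
        using a by (simp add: S_def comm_simps)
      ultimately show "x \<otimes> y \<in> S"
        using C by (simp add: S_def subgroup.m_closed normal.inv_op_closed2)
    next
      fix x assume "x \<in> S"
      moreover from this have "comm a (inv x) = inv x \<otimes> inv (comm a x) \<otimes> x"
        using a by (simp add: S_def comm_simps)
      ultimately show "inv x \<in> S"
        using C by (simp add: S_def subgroup.m_inv_closed normal.inv_op_closed1)
    qed (use a C in \<open>auto simp: S_def comm_def subgroup.one_closed\<close>)
  qed
  then show ?case using Suc.prems(2) by (auto simp: S_def C_def)
qed

end

section \<open>Polynomial sequences in filtered groups\<close>

locale group_filtration = group G for G (structure) +
  fixes H :: "nat \<Rightarrow> 'a set"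
  assumes H_subgroup: "subgroup (H i) G"
    and H_Suc: "H (Suc i) \<subseteq> H i"
    and H_comm: "x \<in> H i \<Longrightarrow> y \<in> H j \<Longrightarrow> comm x y \<in> H (i + j)"
begin

lemma H_carrier: "x \<in> H i \<Longrightarrow> x \<in> carrier G"
  using subgroup.subset[OF H_subgroup] by blast

lemma H_antimono: "i \<le> j \<Longrightarrow> H j \<subseteq> H i"
  by (rule lift_Suc_antimono_le[of H]) (rule H_Suc)

definition diff :: "(nat \<Rightarrow> 'a) \<Rightarrow> nat \<Rightarrow> 'a" where
  "diff f n = f (Suc n) \<otimes> inv (f n)"

text \<open>The bound \<open>t\<close> on the order of the differences makes the closure properties provable by
  induction: the difference of \<open>[f, g]\<close> involves \<open>[f, g]\<close> itself, but only at order \<open>t\<close> when the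
  order \<open>t + 1\<close> is under consideration.\<close>

primrec poly_upto :: "nat \<Rightarrow> nat \<Rightarrow> (nat \<Rightarrow> 'a) \<Rightarrow> bool" where
  "poly_upto 0 i f \<longleftrightarrow> (\<forall>n. f n \<in> H i)"
| "poly_upto (Suc t) i f \<longleftrightarrow> (\<forall>n. f n \<in> H i) \<and> poly_upto t (Suc i) (diff f)"

definition poly_seq :: "nat \<Rightarrow> (nat \<Rightarrow> 'a) \<Rightarrow> bool" where
  "poly_seq i f \<longleftrightarrow> (\<forall>t. poly_upto t i f)"

lemma poly_upto_mem: "poly_upto t i f \<Longrightarrow> f n \<in> H i"
  by (cases t) simp_all

lemma poly_upto_closed: "poly_upto t i f \<Longrightarrow> f n \<in> carrier G"
  using poly_upto_mem H_carrier by blast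

lemma poly_upto_antimono:
  "poly_upto t j f \<Longrightarrow> i \<le> j \<Longrightarrow> poly_upto t i f"
proof (induction t arbitrary: i j f)
  case (Suc t)
  then show ?case using H_antimono[OF Suc.prems(2)] Suc.IH[of "Suc j" "diff f" "Suc i"] by auto
qed (use H_antimono in auto)

lemma poly_upto_SucD: "poly_upto (Suc t) i f \<Longrightarrow> poly_upto t i f"
  by (induction t arbitrary: i f) simp_all

lemma poly_upto_shift: "poly_upto t i f \<Longrightarrow> poly_upto t i (\<lambda>n. f (Suc n))"
proof (induction t arbitrary: i f)
  case (Suc t)
  then show ?case using Suc.IH[of "Suc i" "diff f"] by (simp add: diff_def[abs_def])
qed simp

lemma diff_mult:
  assumes "\<And>n. f n \<in> carrier G" "\<And>n. g n \<in> carrier G"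
  shows "diff (\<lambda>n. f n \<otimes> g n) = (\<lambda>n. diff f n \<otimes> comm (f n) (diff g n) \<otimes> diff g n)"
  using assms by (simp add: fun_eq_iff diff_def comm_simps)

text \<open>Writing \<open>f (n + 1) = f' f\<close> and \<open>g (n + 1) = g' g\<close>, this is the expansion of
  \<open>[f' f, g' g] [f, g]\<inverse>\<close>, arranged so that every factor is a commutator whose weight exceeds that of
  \<open>[f, g]\<close>.\<close>

lemma diff_comm:
  assumes "\<And>n. f n \<in> carrier G" "\<And>n. g n \<in> carrier G"
  shows "diff (\<lambda>n. comm (f n) (g n)) =
    (\<lambda>n. comm (diff f n) (comm (f n) (g (Suc n))) \<otimes>
      (comm (f n) (diff g n) \<otimes> comm (diff g n) (comm (f n) (g n))) \<otimes>
      (comm (comm (f n) (g n)) (comm (diff f n) (g (Suc n))) \<otimes> comm (diff f n) (g (Suc n))))"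
proof
  fix n
  define x y x' y' h where "x = f n" and "y = g n" and "x' = diff f n" and "y' = diff g n"
    and "h = g (Suc n)"
  have car: "x \<in> carrier G" "y \<in> carrier G" "x' \<in> carrier G" "y' \<in> carrier G" "h \<in> carrier G"
    using assms by (simp_all add: x_def y_def x'_def y'_def h_def diff_def)
  have Suc: "f (Suc n) = x' \<otimes> x" "h = y' \<otimes> y"
    using assms by (simp_all add: x_def y_def x'_def y'_def h_def diff_def m_assoc)
  have conj: "c \<otimes> v = comm c v \<otimes> v \<otimes> c" if "c \<in> carrier G" "v \<in> carrier G" for c v
    using that by (simp add: comm_simps)
  define u where "u = comm x' (comm x h)"
  have u: "u \<in> carrier G" using car by (simp add: u_def)
  have "comm (x' \<otimes> x) h = u \<otimes> comm x h \<otimes> comm x' h"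
    using car by (simp add: comm_mult_left u_def)
  also have "comm x h = comm x y' \<otimes> comm y' (comm x y) \<otimes> comm x y"
    using car by (simp add: Suc comm_mult_right)
  finally have "comm (x' \<otimes> x) h =
      u \<otimes> (comm x y' \<otimes> comm y' (comm x y)) \<otimes> (comm x y \<otimes> comm x' h)"
    using car u by (simp add: m_assoc)
  also have "comm x y \<otimes> comm x' h =
      comm (comm x y) (comm x' h) \<otimes> comm x' h \<otimes> comm x y"
    using car by (intro conj) simp_all
  finally have "comm (x' \<otimes> x) h \<otimes> inv (comm x y) =
      u \<otimes> (comm x y' \<otimes> comm y' (comm x y)) \<otimes> (comm (comm x y) (comm x' h) \<otimes> comm x' h)"
    using car u by (simp add: m_assoc)
  then show "diff (\<lambda>n. comm (f n) (g n)) n =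
      comm (diff f n) (comm (f n) (g (Suc n))) \<otimes>
      (comm (f n) (diff g n) \<otimes> comm (diff g n) (comm (f n) (g n))) \<otimes>
      (comm (comm (f n) (g n)) (comm (diff f n) (g (Suc n))) \<otimes> comm (diff f n) (g (Suc n)))"
    unfolding diff_def[of "\<lambda>n. comm (f n) (g n)"] Suc(1) u_def x_def y_def x'_def y'_def h_def .
qed

text \<open>Neither closure property can be proved alone: the difference of a product contains a
  commutator, and the difference of a commutator is a product.\<close>

lemma poly_upto_mult_comm:
  "(\<forall>i f g. poly_upto t i f \<longrightarrow> poly_upto t i g \<longrightarrow> poly_upto t i (\<lambda>n. f n \<otimes> g n)) \<and>
   (\<forall>i j f g. poly_upto t i f \<longrightarrow> poly_upto t j g \<longrightarrow>
      poly_upto t (i + j) (\<lambda>n. comm (f n) (g n)))"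
proof (induction t)
  case 0
  then show ?case using H_subgroup H_comm by (auto intro: subgroup.m_closed)
next
  case (Suc t)
  then have mult: "poly_upto t i (\<lambda>n. f n \<otimes> g n)" if "poly_upto t i f" "poly_upto t i g" for i f g
    using that by blast
  have comm: "poly_upto t l (\<lambda>n. comm (f n) (g n))"
    if "poly_upto t i f" "poly_upto t j g" "l \<le> i + j" for i j l f g
  proof -
    have "poly_upto t (i + j) (\<lambda>n. comm (f n) (g n))" using Suc that(1,2) by blast
    then show ?thesis using that(3) by (rule poly_upto_antimono)
  qed
  show ?case
  proof (intro conjI allI impI)
    fix i f g assume fg: "poly_upto (Suc t) i f" "poly_upto (Suc t) i g"
    then have d: "poly_upto t (Suc i) (diff f)" "poly_upto t (Suc i) (diff g)"
      by simp_all
    have "poly_upto t (Suc i) (\<lambda>n. diff f n \<otimes> comm (f n) (diff g n) \<otimes> diff g n)"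
      by (intro mult d comm[OF poly_upto_SucD[OF fg(1)] d(2)]) simp
    then show "poly_upto (Suc t) i (\<lambda>n. f n \<otimes> g n)"
      using fg H_subgroup
      by (simp add: diff_mult[OF poly_upto_closed[OF fg(1)] poly_upto_closed[OF fg(2)]]
          subgroup.m_closed)
  next
    fix i j f g assume fg: "poly_upto (Suc t) i f" "poly_upto (Suc t) j g"
    note low = fg[THEN poly_upto_SucD] and g_Suc = poly_upto_shift[OF poly_upto_SucD[OF fg(2)]]
    have d: "poly_upto t (Suc i) (diff f)" "poly_upto t (Suc j) (diff g)"
      using fg by simp_all
    have "poly_upto t (Suc (i + j))
      (\<lambda>n. comm (diff f n) (comm (f n) (g (Suc n))) \<otimes>
        (comm (f n) (diff g n) \<otimes> comm (diff g n) (comm (f n) (g n))) \<otimes>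
        (comm (comm (f n) (g n)) (comm (diff f n) (g (Suc n))) \<otimes> comm (diff f n) (g (Suc n))))"
      by (intro mult comm[OF d(1) comm[OF low(1) g_Suc order.refl]] comm[OF low(1) d(2)]
          comm[OF d(2) comm[OF low order.refl]] comm[OF d(1) g_Suc]
          comm[OF comm[OF low order.refl] comm[OF d(1) g_Suc order.refl]]) simp_all
    then show "poly_upto (Suc t) (i + j) (\<lambda>n. comm (f n) (g n))"
      using fg
      by (simp add: diff_comm[OF poly_upto_closed[OF fg(1)] poly_upto_closed[OF fg(2)]] H_comm)
  qed
qed

lemma poly_upto_inv: "poly_upto t i f \<Longrightarrow> poly_upto t i (\<lambda>n. inv (f n))"
proof (induction t arbitrary: i f)
  case (Suc t)
  have f: "f n \<in> carrier G" for n using Suc.prems poly_upto_closed by blast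
  have diff_inv: "diff (\<lambda>n. inv (f n)) = (\<lambda>n. comm (inv (f n)) (inv (diff f n)) \<otimes> inv (diff f n))"
    using f by (simp add: fun_eq_iff diff_def comm_simps)
  have "poly_upto t i (\<lambda>n. inv (f n))" "poly_upto t (Suc i) (\<lambda>n. inv (diff f n))"
    using Suc.IH[OF poly_upto_SucD[OF Suc.prems]] Suc.IH Suc.prems by simp_all
  moreover from this have "poly_upto t (i + Suc i) (\<lambda>n. comm (inv (f n)) (inv (diff f n)))"
    using poly_upto_mult_comm[of t] by blast
  then have "poly_upto t (Suc i) (\<lambda>n. comm (inv (f n)) (inv (diff f n)))"
    by (rule poly_upto_antimono) simp
  ultimately have "poly_upto t (Suc i) (\<lambda>n. comm (inv (f n)) (inv (diff f n)) \<otimes> inv (diff f n))"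
    using poly_upto_mult_comm[of t] by blast
  then show ?case
    using Suc.prems H_subgroup by (simp add: diff_inv subgroup.m_inv_closed)
qed (use H_subgroup in \<open>simp add: subgroup.m_inv_closed\<close>)

lemma poly_seq_mult: "poly_seq i f \<Longrightarrow> poly_seq i g \<Longrightarrow> poly_seq i (\<lambda>n. f n \<otimes> g n)"
  unfolding poly_seq_def using poly_upto_mult_comm by blast

lemma poly_seq_comm:
  "poly_seq i f \<Longrightarrow> poly_seq j g \<Longrightarrow> poly_seq (i + j) (\<lambda>n. comm (f n) (g n))"
  unfolding poly_seq_def using poly_upto_mult_comm by blast

lemma poly_seq_inv: "poly_seq i f \<Longrightarrow> poly_seq i (\<lambda>n. inv (f n))"
  unfolding poly_seq_def using poly_upto_inv by blast

lemma poly_seq_closed: "poly_seq i f \<Longrightarrow> f n \<in> carrier G"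
  unfolding poly_seq_def by (blast intro: poly_upto_closed)

lemma poly_seq_diff: "poly_seq i f \<Longrightarrow> poly_seq (Suc i) (diff f)"
  unfolding poly_seq_def
proof
  fix t assume "\<forall>t. poly_upto t i f"
  then have "poly_upto (Suc t) i f" by (rule spec)
  then show "poly_upto t (Suc i) (diff f)" by simp
qed

text \<open>By Pascal's rule, taking differences lowers \<open>r\<close> by one, while the index rises by one.\<close>

lemma poly_seq_binomial_power:
  assumes "h \<in> H (i + r)"
  shows "poly_seq i (\<lambda>n. h [^] (n choose r))"
  unfolding poly_seq_def
proof
  fix t show "poly_upto t i (\<lambda>n. h [^] (n choose r))"
    using assms
  proof (induction t arbitrary: i r h)
    case 0
    have "h \<in> H i" using 0 H_antimono[of i "i + r"] by auto
    then show ?case by (simp add: subgroup_nat_pow_closed H_subgroup)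
  next
    case (Suc t)
    have h: "h \<in> carrier G" "h \<in> H i"
      using Suc.prems H_carrier H_antimono[of i "i + r"] by auto
    have "poly_upto t (Suc i) (diff (\<lambda>n. h [^] (n choose r)))"
    proof (cases r)
      case 0
      then have "diff (\<lambda>n. h [^] (n choose r)) = (\<lambda>n. \<one> [^] (n choose 0))"
        using h by (simp add: diff_def fun_eq_iff)
      then show ?thesis
        using Suc.IH[of \<one> "Suc i" 0] H_subgroup by (simp add: subgroup.one_closed)
    next
      case (Suc q)
      then have "diff (\<lambda>n. h [^] (n choose r)) = (\<lambda>n. h [^] (n choose q))"
        using h by (simp add: diff_def fun_eq_iff m_assoc flip: nat_pow_mult)
      then show ?thesis
        using Suc.IH[of h "Suc i" q] Suc.prems Suc by simp
    qed
    then show ?case using h by (simp add: subgroup_nat_pow_closed H_subgroup)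
  qed
qed

text \<open>The \<open>r\<close>-th difference of \<open>f\<close> at \<open>n\<close> is \<open>f (n + r)\<close> times a word in the preceding \<open>r\<close> values
  of \<open>f\<close>, which are trivial here.\<close>

lemma poly_seq_next_value:
  assumes "poly_seq i f" "\<And>j. j < r \<Longrightarrow> f (n + j) = \<one>"
  shows "f (n + r) \<in> H (i + r)"
  using assms
proof (induction r arbitrary: i f n)
  case 0
  then show ?case using poly_upto_mem by (auto simp: poly_seq_def)
next
  case (Suc r)
  have "diff f (n + r) \<in> H (Suc i + r)"
  proof (rule Suc.IH)
    show "poly_seq (Suc i) (diff f)" by (rule poly_seq_diff) fact
    fix j assume "j < r"
    then have "f (n + j) = \<one>" "f (n + Suc j) = \<one>"
      using Suc.prems(2)[of j] Suc.prems(2)[of "Suc j"] by simp_all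
    then show "diff f (n + j) = \<one>" by (simp add: diff_def)
  qed
  moreover have "f (n + r) = \<one>" using Suc.prems(2) by simp
  ultimately show ?case using poly_seq_closed[OF Suc.prems(1)] by (simp add: diff_def)
qed

text \<open>Dividing \<open>f\<close> by \<open>n \<mapsto> f r ^ (n choose r)\<close> makes it vanish at \<open>r\<close> too. After finitely many such
  divisions, each of which changes the value at \<open>N\<close> by an element of \<open>K\<close> only, \<open>f\<close> vanishes
  at \<open>N\<close>.\<close>

lemma poly_seq_vanish:
  assumes "subgroup K G"
    and "\<And>q h. q \<ge> r \<Longrightarrow> h \<in> H (i + q) \<Longrightarrow> h [^] (N choose q) \<in> K"
    and "poly_seq i f" "\<And>n. n < r \<Longrightarrow> f n = \<one>"
  shows "f N \<in> K"
  using assms(2-)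
proof (induction "Suc N - r" arbitrary: f r)
  case 0
  then have "f N = \<one>" by simp
  then show ?case by (simp add: subgroup.one_closed[OF assms(1)])
next
  case (Suc d)
  define h where "h = f r"
  have h: "h \<in> H (i + r)"
    using poly_seq_next_value[of i f r 0] Suc.prems by (simp add: h_def)
  have hK: "h [^] (N choose r) \<in> K" using Suc.prems(1)[OF order.refl h] .
  note f = poly_seq_closed[OF Suc.prems(2)]
  define g where "g n = f n \<otimes> inv (h [^] (n choose r))" for n
  have "g N \<in> K"
  proof (rule Suc.hyps(1))
    show "d = Suc N - Suc r" using Suc.hyps(2) by simp
    show "poly_seq i g"
      unfolding g_def by (intro poly_seq_mult poly_seq_inv poly_seq_binomial_power h Suc.prems)
    show "g n = \<one>" if "n < Suc r" for n
      using that Suc.prems(3)[of n] f[of r]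
      by (cases "n = r") (auto simp: g_def h_def binomial_eq_0)
  qed (use Suc.prems(1) in auto)
  moreover have "f N = g N \<otimes> h [^] (N choose r)"
    using f H_carrier[OF h] by (simp add: g_def m_assoc)
  ultimately show ?case using hK by (simp add: subgroup.m_closed[OF assms(1)])
qed

text \<open>Here \<open>poly_seq_vanish\<close> is applied to \<open>n \<mapsto> f n (f 1) ^ -n\<close>, which vanishes at \<open>0\<close> and \<open>1\<close>; this is
  why only \<open>q \<ge> 2\<close> occurs.\<close>

lemma poly_seq_power_mem:
  assumes K: "subgroup K G"
    and H: "\<And>q h. q \<ge> 2 \<Longrightarrow> h \<in> H (i + q) \<Longrightarrow> h [^] (N choose q) \<in> K"
    and f: "poly_seq i f" "f 0 = \<one>" "f N \<in> K"
  shows "f 1 [^] N \<in> K"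
proof -
  have f1: "f 1 \<in> H (i + 1)"
    using poly_seq_next_value[of i f 1 0] f by simp
  note car = poly_seq_closed[OF f(1)] H_carrier[OF f1]
  define g where "g n = f n \<otimes> inv (f 1 [^] (n choose 1))" for n
  have "g N \<in> K"
  proof (rule poly_seq_vanish[OF K H])
    show "poly_seq i g"
      unfolding g_def by (intro poly_seq_mult poly_seq_inv poly_seq_binomial_power f f1)
    show "g n = \<one>" if "n < 2" for n
      using that f(2) car by (cases n) (auto simp: g_def)
  qed
  moreover have "f 1 [^] N = inv (g N) \<otimes> f N"
    using car by (simp add: g_def inv_mult_group m_assoc)
  ultimately show ?thesis
    using f(3) by (simp add: subgroup.m_closed[OF K] subgroup.m_inv_closed[OF K])
qed

end

section \<open>Powers in the lower central series\<close>

context group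
begin

text \<open>With the dummy value \<open>lower_central G 0 = carrier G\<close>, the lower central series is a filtration
  in which the terms of index \<open>0\<close> and \<open>1\<close> agree; this is what makes \<open>n \<mapsto> x ^ n\<close> a polynomial
  sequence of index \<open>0\<close>.\<close>

lemma lower_central_filtration: "group_filtration G (lower_central G)"
proof (intro group_filtration.intro group_filtration_axioms.intro is_group)
  show "subgroup (lower_central G i) G" for i
    unfolding lower_central_def by (rule iterated_commutator_subgroup[OF normal_self])
  show "lower_central G (Suc i) \<subseteq> lower_central G i" for i
    unfolding lower_central_def by (rule iterated_commutator_antimono[OF normal_self]) simp
  fix x y i j assume xy: "x \<in> lower_central G i" "y \<in> lower_central G j"
  have normal: "lower_central G n \<lhd> G" for n
    unfolding lower_central_def by (rule iterated_commutator_normal[OF normal_self])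
  have car: "x \<in> carrier G" "y \<in> carrier G"
    using xy subgroup.subset[OF normal_imp_subgroup[OF normal]] by blast+
  show "comm x y \<in> lower_central G (i + j)"
  proof (cases "i = 0 \<or> j = 0")
    case True
    then show ?thesis using xy car comm_mem_normal[OF normal] by auto
  next
    case False
    then have "Suc (i - 1 + (j - 1)) = i + j - 1" by linarith
    then show ?thesis
      using comm_iterated_commutator[of x "i - 1" y "j - 1"] xy
      unfolding lower_central_def by (simp only:)
  qed
qed

text \<open>The elements \<open>w\<close> with the asserted property form a subgroup because polynomial sequences are
  closed under products and inverses; so it is enough to deal with commutators \<open>[h, y]\<close>, where the
  sequence for \<open>h\<close> is commutated with the constant \<open>y\<close>. A constant is a polynomial sequence of
  index \<open>1\<close>, so that the index goes up by one, as required.\<close>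

lemma lower_central_interpolation:
  assumes R: "R \<lhd> G" and pow: "\<And>x. x \<in> carrier G \<Longrightarrow> x [^] (N::nat) \<in> R"
    and w: "w \<in> lower_central G (Suc s)"
  shows "\<exists>f. group_filtration.poly_seq G (lower_central G) s f \<and> f 0 = \<one> \<and> f 1 = w \<and>
    f N \<in> iterated_commutator G R s"
proof -
  interpret group_filtration G "lower_central G" by (rule lower_central_filtration)
  let ?W = "\<lambda>s f. poly_seq s f \<and> f 0 = \<one> \<and> f N \<in> iterated_commutator G R s"
  have H1: "x \<in> lower_central G (0 + 1)" if "x \<in> carrier G" for x
    using that by (simp add: lower_central_def)
  have "\<exists>f. ?W s f \<and> f 1 = w"
    using w
  proof (induction s arbitrary: w)
    case 0
    then have w: "w \<in> carrier G" by (simp add: lower_central_def)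
    have "poly_seq 0 (\<lambda>n. w [^] (n choose 1))" by (rule poly_seq_binomial_power[OF H1[OF w]])
    then show ?case using w pow[OF w] by (intro exI[of _ "\<lambda>n. w [^] n"]) simp
  next
    case (Suc s)
    note sub = iterated_commutator_subgroup[OF R, of "Suc s"]
    define Q where "Q = {w. \<exists>f. ?W (Suc s) f \<and> f 1 = w}"
    have "commutator_subgroup G (lower_central G (Suc s)) (carrier G) \<subseteq> Q"
    proof (rule commutator_subgroup_le)
      fix h y assume h: "h \<in> lower_central G (Suc s)" and y: "y \<in> carrier G"
      from Suc.IH[OF h] obtain f where f: "?W s f" "f 1 = h" by blast
      have "poly_seq 1 (\<lambda>n. y [^] (n choose 0))"
        using H1[OF y] by (intro poly_seq_binomial_power) simp
      then have "poly_seq (s + 1) (\<lambda>n. comm (f n) y)"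
        using f y by (intro poly_seq_comm) simp_all
      then show "comm h y \<in> Q"
        using f y unfolding Q_def
        by (auto intro!: exI[of _ "\<lambda>n. comm (f n) y"] comm_in_commutator_subgroup)
    next
      show "subgroup Q G"
      proof
        show "Q \<subseteq> carrier G" using poly_seq_closed by (auto simp: Q_def)
        have "poly_seq (Suc s) (\<lambda>n. \<one> [^] (n choose 0))"
          by (intro poly_seq_binomial_power subgroup.one_closed H_subgroup)
        then show "\<one> \<in> Q"
          using subgroup.one_closed[OF sub] unfolding Q_def by (intro CollectI exI[of _ "\<lambda>n. \<one>"]) simp
      next
        fix x y assume "x \<in> Q" "y \<in> Q"
        then obtain f g where "?W (Suc s) f" "f 1 = x" "?W (Suc s) g" "g 1 = y"
          unfolding Q_def by blast
        then show "x \<otimes> y \<in> Q"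
          using subgroup.m_closed[OF sub] unfolding Q_def
          by (intro CollectI exI[of _ "\<lambda>n. f n \<otimes> g n"]) (simp add: poly_seq_mult)
      next
        fix x assume "x \<in> Q"
        then obtain f where "?W (Suc s) f" "f 1 = x" unfolding Q_def by blast
        then show "inv x \<in> Q"
          using subgroup.m_inv_closed[OF sub] unfolding Q_def
          by (intro CollectI exI[of _ "\<lambda>n. inv (f n)"]) (simp add: poly_seq_inv)
      qed
    qed
    then have "w \<in> Q" using Suc.prems by (auto simp: lower_central_def)
    then show ?case unfolding Q_def by (rule CollectD)
  qed
  then show ?thesis by blast
qed

end

text \<open>In \<open>q * (N choose q) = N * (N - 1 choose q - 1)\<close> with \<open>N = p ^ (a + m)\<close>, the factor \<open>q\<close> can
  absorb at most \<open>m\<close> of the \<open>a + m\<close> factors \<open>p\<close>.\<close>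

lemma prime_power_dvd_binomial:
  fixes p :: nat
  assumes p: "Factorial_Ring.prime p" and q: "0 < q" "q < p ^ Suc m"
  shows "p ^ a dvd (p ^ (a + m) choose q)"
proof -
  define N where "N = p ^ (a + m)"
  have "N > 0" using p by (simp add: N_def prime_gt_0_nat)
  then have "q * (N choose q) = N * ((N - 1) choose (q - 1))"
    using q binomial_absorption[of "q - 1" "N"] by simp
  then have "p ^ (a + m) dvd q * (N choose q)" by (simp add: N_def)
  then obtain i j where ij: "i + j = a + m" "p ^ i dvd q" "p ^ j dvd (N choose q)"
    using prime_elem_power_dvd_prod[OF _ prime_imp_prime_elem[OF p]] by blast
  have "\<not> p ^ Suc m dvd q" using q dvd_imp_le by fastforce
  then have "\<not> Suc m \<le> i" using ij(2) le_imp_power_dvd dvd_trans by blast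
  then have "a \<le> j" using ij(1) by simp
  then show ?thesis
    using ij(3) le_imp_power_dvd dvd_trans unfolding N_def by blast
qed

context group
begin

lemma pow_mem_of_dvd:
  assumes "subgroup K G" "x \<in> carrier G" "x [^] (n::nat) \<in> K" "n dvd n'"
  shows "x [^] n' \<in> K"
  using assms(4) subgroup_nat_pow_closed[OF assms(1,3)] assms(2)
  by (auto simp: dvd_def nat_pow_pow)

text \<open>Each step of the induction on \<open>d\<close> costs a factor \<open>p ^ m\<close>, because no higher power of \<open>p\<close> can
  be lost in passing from \<open>N\<close> to \<open>N choose q\<close> with \<open>q \<le> k\<close>.\<close>

lemma lower_central_power_mem:
  fixes p :: nat
  assumes p: "Factorial_Ring.prime p" and R: "R \<lhd> G"
    and class_R: "lower_central G (Suc k) \<subseteq> R"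
    and exp_R: "\<And>x. x \<in> carrier G \<Longrightarrow> x [^] (p ^ e) \<in> R"
    and k: "k < p ^ Suc m"
    and "d < k" "w \<in> lower_central G (c + k - d)"
  shows "w [^] (p ^ (e + m * d)) \<in> iterated_commutator G R c"
  using assms(6,7)
proof (induction d arbitrary: w rule: less_induct)
  case (less d)
  interpret group_filtration G "lower_central G" by (rule lower_central_filtration)
  let ?K = "iterated_commutator G R c"
  define N s where "N = p ^ (e + m * d)" and "s = c + k - d - 1"
  have s: "Suc s = c + k - d" "c \<le> s" using less.prems(1) by (auto simp: s_def)
  note K = iterated_commutator_subgroup[OF R, of c]
  have "lower_central G (Suc (k + c)) = iterated_commutator G (lower_central G (Suc k)) c"
    by (simp add: lower_central_def iterated_commutator_add)
  then have bottom: "lower_central G (Suc (k + c)) \<subseteq> ?K"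
    using iterated_commutator_mono[OF class_R R] by simp
  have "x [^] N \<in> R" if "x \<in> carrier G" for x
    using pow_mem_of_dvd[OF normal_imp_subgroup[OF R] that exp_R[OF that]]
    by (simp add: N_def le_imp_power_dvd)
  then obtain f where f: "poly_seq s f" "f 0 = \<one>" "f 1 = w" "f N \<in> iterated_commutator G R s"
    using lower_central_interpolation[OF R, of N w s] less.prems(2) s(1) by auto
  have "f 1 [^] N \<in> ?K"
  proof (rule poly_seq_power_mem[OF K _ f(1,2)])
    show "f N \<in> ?K" using f(4) iterated_commutator_antimono[OF R s(2)] by blast
    fix q h assume q: "q \<ge> 2" and h: "h \<in> lower_central G (s + q)"
    \<comment> \<open>In the first case the index \<open>s + q\<close> exceeds \<open>c + k\<close>.\<close>
    show "h [^] (N choose q) \<in> ?K"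
    proof (cases "q > k \<or> d = 0")
      case True
      then have "Suc (k + c) \<le> s + q" using q less.prems(1) by (auto simp: s_def)
      then have "h \<in> ?K" using h bottom H_antimono by blast
      then show ?thesis by (rule subgroup_nat_pow_closed[OF K])
    next
      case False
      then obtain d' where d: "d = Suc d'" by (cases d) auto
      have "c + k - d' \<le> s + q" using q less.prems(1) by (auto simp: s_def d)
      then have "h [^] (p ^ (e + m * d')) \<in> ?K"
        using h H_antimono less.prems(1) by (intro less.IH) (auto simp: d)
      moreover have "p ^ (e + m * d') dvd (N choose q)"
        using prime_power_dvd_binomial[OF p, of q m "e + m * d'"] False q k
        by (simp add: N_def d algebra_simps)
      ultimately show ?thesis using pow_mem_of_dvd[OF K H_carrier[OF h]] by blast
    qed
  qed
  then show ?case using f(3) by (simp add: N_def)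
qed

end

section \<open>Exponents\<close>

lemma nat_pow_group_exponent:
  assumes "group_exponent G > 0" "x \<in> carrier G"
  shows "x [^]\<^bsub>G\<^esub> group_exponent G = \<one>\<^bsub>G\<^esub>"
proof -
  let ?P = "\<lambda>n::nat. n > 0 \<and> (\<forall>x\<in>carrier G. x [^]\<^bsub>G\<^esub> n = \<one>\<^bsub>G\<^esub>)"
  have ex: "\<exists>n. ?P n" using assms(1) by (auto simp: group_exponent_def split: if_splits)
  then have "group_exponent G = (LEAST n. ?P n)" by (simp add: group_exponent_def)
  then show ?thesis using LeastI_ex[OF ex] assms(2) by simp
qed

text \<open>The remainder of \<open>n\<close> modulo the exponent annihilates \<open>H\<close> too, and is smaller than the exponent.
  The powers involved are computed in an ambient group.\<close>

lemma (in group) group_exponent_dvd: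
  assumes H: "carrier H \<subseteq> carrier G" "\<one>\<^bsub>H\<^esub> = \<one>" "monoid.mult H = monoid.mult G"
    and n: "n > 0" "\<And>x. x \<in> carrier H \<Longrightarrow> x [^] n = \<one>"
  shows "group_exponent H dvd n"
proof -
  have pow: "x [^]\<^bsub>H\<^esub> i = x [^] i" for x and i :: nat
    by (simp add: nat_pow_def H(2,3))
  let ?P = "\<lambda>n::nat. n > 0 \<and> (\<forall>x\<in>carrier H. x [^]\<^bsub>H\<^esub> n = \<one>\<^bsub>H\<^esub>)"
  let ?e = "LEAST n. ?P n"
  have "?P n" using n by (simp add: pow H(2))
  then have e: "?P ?e" by (rule LeastI)
  have "n mod ?e = 0"
  proof (rule ccontr)
    assume "n mod ?e \<noteq> 0"
    moreover have "x [^] (n mod ?e) = \<one>" if x: "x \<in> carrier H" for x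
    proof -
      have xG: "x \<in> carrier G" using x H(1) by blast
      have xe: "x [^] ?e = \<one>" using e x by (simp add: pow H(2))
      have "x [^] n = x [^] (?e * (n div ?e)) \<otimes> x [^] (n mod ?e)"
        using xG by (simp only: nat_pow_mult mult_div_mod_eq)
      also have "x [^] (?e * (n div ?e)) = \<one>"
        using xG xe by (simp flip: nat_pow_pow)
      finally show ?thesis using n(2)[OF x] xG by simp
    qed
    ultimately have "?P (n mod ?e)" by (simp add: pow H(2))
    then have "?e \<le> n mod ?e" by (rule Least_le)
    moreover have "n mod ?e < ?e" using e by (intro mod_less_divisor) (rule conjunct1)
    ultimately show False by linarith
  qed
  moreover have "group_exponent H = ?e" using \<open>?P n\<close> unfolding group_exponent_def by (intro if_P exI)
  ultimately show ?thesis by (simp add: dvd_eq_mod_eq_0)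
qed

section \<open>The exponent of the nilpotent multiplier\<close>

lemma (in group_hom) iterated_commutator_hom:
  assumes "A \<lhd> G" "x \<in> iterated_commutator G A n"
  shows "h x \<in> iterated_commutator H (h ` A) n"
  using assms(2)
proof (induction n arbitrary: x)
  case (Suc n)
  have sub: "iterated_commutator G A n \<subseteq> carrier G"
    using G.iterated_commutator_subgroup[OF assms(1)] subgroup.subset by blast
  let ?X = "\<Union>a\<in>iterated_commutator G A n. \<Union>b\<in>carrier G. {G.comm a b}"
  have X: "?X \<subseteq> carrier G" using sub G.comm_closed by blast
  have "h (G.comm a b) = H.comm (h a) (h b)" if "a \<in> carrier G" "b \<in> carrier G" for a b
    using that by (simp add: G.comm_def H.comm_def)
  then have "h ` ?X \<subseteq> (\<Union>a\<in>iterated_commutator H (h ` A) n. \<Union>b\<in>carrier H. {H.comm a b})"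
    using Suc.IH sub by fastforce
  then have "generate H (h ` ?X) \<subseteq> iterated_commutator H (h ` A) (Suc n)"
    by (simp add: H.commutator_subgroup_alt H.mono_generate)
  moreover have "h x \<in> h ` generate G ?X"
    using Suc.prems by (simp add: G.commutator_subgroup_alt)
  ultimately show ?case using generate_img[OF X] by auto
qed simp

lemma free_presentation_epi:
  assumes "free_presentation G F R" "group G"
  obtains h where "group_hom F G h" "h ` carrier F = carrier G"
    "\<And>x. x \<in> carrier F \<Longrightarrow> h x = \<one>\<^bsub>G\<^esub> \<Longrightarrow> x \<in> R"
proof -
  have F: "group F" and R: "R \<lhd> F" and iso: "F Mod R \<cong> G"
    using assms by (auto simp: free_presentation_def free_on_def)
  interpret F: group F by fact
  interpret R: normal R F by fact
  obtain g where g: "g \<in> iso (F Mod R) G" using iso by (auto simp: is_iso_def)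
  then interpret g: group_hom "F Mod R" G g
    using R.factorgroup_is_group assms(2)
    by (simp add: group_hom_def group_hom_axioms_def iso_def)
  let ?h = "g \<circ> (\<lambda>x. R #>\<^bsub>F\<^esub> x)"
  have hom: "(\<lambda>x. R #>\<^bsub>F\<^esub> x) \<in> hom F (F Mod R)" by (rule R.r_coset_hom_Mod)
  have img: "(\<lambda>x. R #>\<^bsub>F\<^esub> x) ` carrier F = carrier (F Mod R)"
    by (auto simp: FactGroup_def RCOSETS_def)
  have inj: "inj_on g (carrier (F Mod R))" and surj: "g ` carrier (F Mod R) = carrier G"
    using g by (auto simp: iso_def bij_betw_def)
  show thesis
  proof
    show "group_hom F G ?h"
      using F assms(2) hom_compose[OF hom g.homh] by (simp add: group_hom_def group_hom_axioms_def)
    show "?h ` carrier F = carrier G" by (simp only: image_comp [symmetric] img surj)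
    fix x assume x: "x \<in> carrier F" "?h x = \<one>\<^bsub>G\<^esub>"
    then have "g (R #>\<^bsub>F\<^esub> x) = g \<one>\<^bsub>F Mod R\<^esub>" using g.hom_one by simp
    moreover have "R #>\<^bsub>F\<^esub> x \<in> carrier (F Mod R)" using x(1) img by blast
    ultimately have "R #>\<^bsub>F\<^esub> x = \<one>\<^bsub>F Mod R\<^esub>"
      using inj g.G.one_closed by (blast dest: inj_onD)
    then show "x \<in> R" using F.coset_join1[OF _ x(1) R.subgroup_axioms] by simp
  qed
qed

lemma less_power_Suc_floor_log:
  assumes "p > 1" "k \<ge> 1"
  shows "k < p ^ Suc (nat \<lfloor>log (real p) (real k)\<rfloor>)"
proof -
  define n where "n = Suc (nat \<lfloor>log (real p) (real k)\<rfloor>)"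
  have "log (real p) (real k) < real n" unfolding n_def by linarith
  then have "real k < real p powr real n"
    using assms by (subst (asm) log_less_iff) auto
  also have "\<dots> = real (p ^ n)"
    using assms by (simp add: powr_realpow)
  finally show ?thesis by (simp only: n_def of_nat_less_iff)
qed

theorem theorem3p3:
  fixes G :: "('a, 'b) monoid_scheme"
    and F :: "('f, 'd) monoid_scheme"
    and R :: "'f set"
    and p k e m c :: nat
  assumes "Factorial_Ring.prime p"
    and "p_group p G"
    and "k \<ge> 1"
    and "nilpotent_of_class G k"
    and "group_exponent G = p ^ e"
    and "m = nat \<lfloor>log (real p) (real k)\<rfloor>"
    and "c \<ge> 1"
    and "free_presentation G F R"
  shows "group_exponent (nilpotent_multiplier c F R) dvd group_exponent G * p ^ (m * (k - 1))"
proof -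
  have G: "group G" using assms(2) by (simp add: p_group_def)
  have R: "R \<lhd> F" using assms(8) by (simp add: free_presentation_def)
  obtain h where h: "group_hom F G h" "h ` carrier F = carrier G"
    and ker: "\<And>x. x \<in> carrier F \<Longrightarrow> h x = \<one>\<^bsub>G\<^esub> \<Longrightarrow> x \<in> R"
    using free_presentation_epi[OF assms(8) G] by blast
  interpret group_hom F G h by fact
  define K N where "K = iterated_commutator F R c" and "N = p ^ (e + m * (k - 1))"
  have p0: "p > 0" using assms(1) by (rule prime_gt_0_nat)
  have KN: "K \<lhd> F" unfolding K_def by (rule G.iterated_commutator_normal[OF R])
  interpret K: normal K F by fact
  have class_R: "lower_central F (Suc k) \<subseteq> R"
  proof
    fix x assume x: "x \<in> lower_central F (Suc k)"
    then have xF: "x \<in> carrier F"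
      using G.iterated_commutator_subgroup[OF G.normal_self] subgroup.subset
      unfolding lower_central_def by blast
    have "h x \<in> lower_central G (Suc k)"
      using iterated_commutator_hom[OF G.normal_self] x h(2) by (simp add: lower_central_def)
    then show "x \<in> R" using assms(4) ker[OF xF] by (simp add: nilpotent_of_class_def)
  qed
  have exp_R: "x [^]\<^bsub>F\<^esub> (p ^ e) \<in> R" if "x \<in> carrier F" for x
    using that ker nat_pow_group_exponent[of G "h x"] assms(5) p0 by (simp add: hom_nat_pow)
  have "k < p ^ Suc m"
    using less_power_Suc_floor_log[of p k] prime_gt_1_nat[OF assms(1)] assms(3,6) by simp
  then have power: "x [^]\<^bsub>F\<^esub> N \<in> K" if "x \<in> lower_central F (c + 1)" for x
    using G.lower_central_power_mem[OF assms(1) R class_R exp_R, of m "k - 1" x c] that assms(3)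
    by (simp add: K_def N_def)
  let ?X = "R \<inter> lower_central F (c + 1)"
  have XF: "?X \<subseteq> carrier F"
    using normal_imp_subgroup[OF R] subgroup.subset by blast
  interpret Q: group "F Mod K" by (rule K.factorgroup_is_group)
  interpret q: group_hom F "F Mod K" "\<lambda>x. K #>\<^bsub>F\<^esub> x"
    using K.r_coset_hom_Mod G.group_axioms Q.group_axioms
    by (simp add: group_hom_def group_hom_axioms_def)
  have carrier: "carrier (nilpotent_multiplier c F R) = (\<lambda>x. K #>\<^bsub>F\<^esub> x) ` ?X"
    by (auto simp: nilpotent_multiplier_def K_def FactGroup_def RCOSETS_def r_coset_def)
  have "group_exponent (nilpotent_multiplier c F R) dvd N"
  proof (rule Q.group_exponent_dvd)
    show "carrier (nilpotent_multiplier c F R) \<subseteq> carrier (F Mod K)"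
      using XF q.hom_closed unfolding carrier by blast
    show "\<one>\<^bsub>nilpotent_multiplier c F R\<^esub> = \<one>\<^bsub>F Mod K\<^esub>"
      by (simp add: nilpotent_multiplier_def K_def)
    show "monoid.mult (nilpotent_multiplier c F R) = monoid.mult (F Mod K)"
      by (simp add: nilpotent_multiplier_def K_def set_mult_def fun_eq_iff)
    show "N > 0" using p0 by (simp add: N_def)
    fix y assume "y \<in> carrier (nilpotent_multiplier c F R)"
    then obtain x where x: "x \<in> ?X" "y = K #>\<^bsub>F\<^esub> x" unfolding carrier by blast
    then have "y [^]\<^bsub>F Mod K\<^esub> N = K #>\<^bsub>F\<^esub> (x [^]\<^bsub>F\<^esub> N)"
      using XF q.hom_nat_pow by auto
    also have "\<dots> = K"
      using power x XF by (intro G.coset_join2 K.subgroup_axioms) auto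
    finally show "y [^]\<^bsub>F Mod K\<^esub> N = \<one>\<^bsub>F Mod K\<^esub>" by simp
  qed
  then show ?thesis using assms(5) by (simp add: N_def power_add)
qed

end
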